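(* Let $(R,\oplus,\otimes)$ be a commutative ring, i.e. a commutative semiring (identities $\mathbb{O}$ for $\oplus$ and $\mathbf{1}$ for $\otimes$) with an operation $\ominus$ satisfying $(a\ominus b)\oplus b=a$ for all $a,b\in R$. Assume $D\subseteq\Gamma$, and let $\Pi$ be the set of prefixes of patterns in $\Pi^\circ$, together with all empty patterns $\varepsilon_s$, $s\in[0,n]$. Consider the following algorithm. 1. Set $W_0(\varepsilon_0):=\mathbf{1}$. 2. For $s=1,\ldots,n$, traverse the nodes $\alpha\in\Pi_s$ of the tree $G[\Pi_s]$ starting from the leaves and set $$M_s(\alpha):=\phi(\alpha)\otimes\Big[W_{s-1}(\alpha^-)\ominus\bigoplus_{(\alpha,\beta)\in E[\Pi_s]}W_{s-1}(\beta^-)\Big],\qquad W_s(\alpha):=M_s(\alpha)\oplus\bigoplus_{(\alpha,\beta)\in E[\Pi_s]}W_s(\beta),$$ except that for $\alpha=\varepsilon_s$ one sets $M_s(\alpha):=\mathbb{O}$ instead of using the first formula. 3. Return $W_n(\varepsilon_n)$. Then the algorithm is correct, i.e. it returns $Z=\bigoplus_{x\in D^{1:n}}f(x)$.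
   Context: $D$ is a finite alphabet, $n\ge1$, and $\Gamma$ is a finite set of non-empty words over $D$ (letters of $D$ are identified with words of length one). A pattern is a pair $\alpha=([i,j],w)$ where $[i,j]$ is an integer interval in $[1,n]$, possibly empty ($j\ge i-1$), and $w=w_i\ldots w_j$ is a word over $D$ of length $|\alpha|=j-i+1$. For $s\in[0,n]$, $\varepsilon_s=([s+1,s],\varepsilon)$ is the empty pattern at $s$. The concatenation of $([i,j],w)$ and $([j+1,k],v)$ is $([i,k],wv)$. The symbol $\ast$ denotes an arbitrary possibly empty pattern and $+$ an arbitrary non-empty pattern; e.g. $x=\ast\alpha\ast$ means that $\alpha$ is a subpattern of $x$ (at its own position), $x=\ast\alpha$ that $\alpha$ is a suffix of $x$, $x=\alpha\ast$ that $\alpha$ is a prefix of $x$. $D^{i:j}$ is the set of patterns with interval $[i,j]$. For non-empty $\alpha$, $\alpha^-$ is its prefix of length $|\alpha|-1$. $\Pi^\circ=\{([i,j],\alpha)\mid\alpha\in\Gamma,\ [i,j]\subseteq[1,n],\ j-i+1=|\alpha|\}$. For a set of patterns $\Pi$, $\Pi_s$ is the set of patterns in $\Pi$ ending at position $s$, i.e. of the form $([\cdot,s],\cdot)$. $G[\Pi_s]=(\Pi_s,E[\Pi_s])$ is the Hasse diagram of $\Pi_s$ under the order "$\alpha\preceq\beta$ iff $\alpha$ is a suffix of $\beta$", with $(\alpha,\beta)\in E[\Pi_s]$ iff $\alpha\prec\beta$ and there is no $\gamma\in\Pi_s$ with $\alpha\prec\gamma\prec\beta$; it is a tree rooted at $\varepsilon_s$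 when $\varepsilon_s\in\Pi_s$. Fixed constants $c_\alpha\in R$ are given for $\alpha\in\Pi^\circ$. The cost of a pattern $x$ is $f(x)=\bigotimes_{\alpha\in\Pi^\circ,\,x=\ast\alpha\ast}c_\alpha$, and $\phi(\alpha)=\bigotimes_{\beta\in\Pi^\circ,\,\alpha=\ast\beta}c_\beta$. Empty $\oplus$ and $\otimes$ equal $\mathbb{O}$ and $\mathbf{1}$ respectively. *)

theory Defs
  imports Main
begin

type_synonym 'a pattern = "(nat \<times> nat) \<times> 'a list"

text \<open>
  A pattern \<open>([i,j], w)\<close> is encoded by the endpoints of its interval and its word.
  The equation \<open>j + 1 = i + length w\<close> is \<open>j - i + 1 = length w\<close> without truncated
  subtraction; it also entails \<open>j \<ge> i - 1\<close>, so empty intervals \<open>[s+1,s]\<close> with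
  \<open>0 \<le> s \<le> n\<close> are included.
\<close>
definition patterns :: "'a set \<Rightarrow> nat \<Rightarrow> 'a pattern set" where
  "patterns D n =
    {((i, j), w) | i j w. 1 \<le> i \<and> j \<le> n \<and> j + 1 = i + length w \<and> set w \<subseteq> D}"

definition empty_pattern :: "nat \<Rightarrow> 'a pattern" where
  "empty_pattern s = ((s + 1, s), [])"

definition is_concat :: "'a pattern \<Rightarrow> 'a pattern \<Rightarrow> 'a pattern \<Rightarrow> bool" where
  "is_concat \<alpha> \<beta> \<gamma> \<longleftrightarrow>
    (\<exists>i j k w v. \<alpha> = ((i, j), w) \<and> \<beta> = ((j + 1, k), v) \<and> \<gamma> = ((i, k), w @ v))"

definition prefix_pattern :: "'a set \<Rightarrow> nat \<Rightarrow> 'a pattern \<Rightarrow> 'a pattern \<Rightarrow> bool" where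
  "prefix_pattern D n \<alpha> x \<longleftrightarrow> (\<exists>\<gamma>\<in>patterns D n. is_concat \<alpha> \<gamma> x)"

definition suffix_pattern :: "'a set \<Rightarrow> nat \<Rightarrow> 'a pattern \<Rightarrow> 'a pattern \<Rightarrow> bool" where
  "suffix_pattern D n \<alpha> x \<longleftrightarrow> (\<exists>\<gamma>\<in>patterns D n. is_concat \<gamma> \<alpha> x)"

definition sub_pattern :: "'a set \<Rightarrow> nat \<Rightarrow> 'a pattern \<Rightarrow> 'a pattern \<Rightarrow> bool" where
  "sub_pattern D n \<alpha> x \<longleftrightarrow>
    (\<exists>\<gamma>\<in>patterns D n. \<exists>\<delta>\<in>patterns D n. \<exists>y\<in>patterns D n.
      is_concat \<gamma> \<alpha> y \<and> is_concat y \<delta> x)"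

definition patterns_on :: "'a set \<Rightarrow> nat \<Rightarrow> nat \<Rightarrow> nat \<Rightarrow> 'a pattern set" where
  "patterns_on D n i j = {x \<in> patterns D n. fst x = (i, j)}"

text \<open>The pattern \<open>\<alpha>\<^sup>-\<close>; only meaningful for non-empty \<open>\<alpha>\<close>.\<close>
definition drop_last :: "'a pattern \<Rightarrow> 'a pattern" where
  "drop_last \<alpha> = ((fst (fst \<alpha>), snd (fst \<alpha>) - 1), butlast (snd \<alpha>))"

definition base_patterns :: "nat \<Rightarrow> 'a list set \<Rightarrow> 'a pattern set" where
  "base_patterns n \<Gamma> =
    {((i, j), w) | i j w. w \<in> \<Gamma> \<and> 1 \<le> i \<and> j \<le> n \<and> j + 1 = i + length w}"

definition all_patterns :: "'a set \<Rightarrow> nat \<Rightarrow> 'a list set \<Rightarrow> 'a pattern set" where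
  "all_patterns D n \<Gamma> =
    {\<alpha> \<in> patterns D n. \<exists>\<beta>\<in>base_patterns n \<Gamma>. prefix_pattern D n \<alpha> \<beta>}
    \<union> {empty_pattern s | s. s \<le> n}"

definition ending_at :: "'a pattern set \<Rightarrow> nat \<Rightarrow> 'a pattern set" where
  "ending_at P s = {\<alpha> \<in> P. snd (fst \<alpha>) = s}"

definition strict_suffix_pattern :: "'a set \<Rightarrow> nat \<Rightarrow> 'a pattern \<Rightarrow> 'a pattern \<Rightarrow> bool" where
  "strict_suffix_pattern D n \<alpha> \<beta> \<longleftrightarrow> suffix_pattern D n \<alpha> \<beta> \<and> \<alpha> \<noteq> \<beta>"

definition hasse :: "'a set \<Rightarrow> nat \<Rightarrow> 'a pattern set \<Rightarrow> ('a pattern \<times> 'a pattern) set" where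
  "hasse D n S =
    {(\<alpha>, \<beta>). \<alpha> \<in> S \<and> \<beta> \<in> S \<and> strict_suffix_pattern D n \<alpha> \<beta> \<and>
      \<not> (\<exists>\<gamma>\<in>S. strict_suffix_pattern D n \<alpha> \<gamma> \<and> strict_suffix_pattern D n \<gamma> \<beta>)}"

text \<open>
  The sort \<open>{comm_semiring_0, comm_monoid_mult}\<close> describes commutative semirings with both
  identities, where \<open>0\<close> is absorbing. Unlike \<open>comm_semiring_1\<close> it does not demand \<open>0 \<noteq> 1\<close>.
\<close>
definition cost ::
  "'a set \<Rightarrow> nat \<Rightarrow> 'a list set \<Rightarrow> ('a pattern \<Rightarrow> 'r::{comm_semiring_0, comm_monoid_mult})
    \<Rightarrow> 'a pattern \<Rightarrow> 'r" where
  "cost D n \<Gamma> c x = (\<Prod>\<alpha>\<in>{\<alpha> \<in> base_patterns n \<Gamma>. sub_pattern D n \<alpha> x}. c \<alpha>)"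

definition suffix_cost ::
  "'a set \<Rightarrow> nat \<Rightarrow> 'a list set \<Rightarrow> ('a pattern \<Rightarrow> 'r::{comm_semiring_0, comm_monoid_mult})
    \<Rightarrow> 'a pattern \<Rightarrow> 'r" where
  "suffix_cost D n \<Gamma> c \<alpha> = (\<Prod>\<beta>\<in>{\<beta> \<in> base_patterns n \<Gamma>. suffix_pattern D n \<beta> \<alpha>}. c \<beta>)"

text \<open>
  A traversal starting from the leaves: every node is visited once, and no node is
  visited before one of its children.
\<close>
definition leaves_first :: "'a set \<Rightarrow> nat \<Rightarrow> 'a pattern set \<Rightarrow> 'a pattern list \<Rightarrow> bool" where
  "leaves_first D n S \<alpha>s \<longleftrightarrow>
    distinct \<alpha>s \<and> set \<alpha>s = S \<and> sorted_wrt (\<lambda>\<alpha> \<beta>. (\<alpha>, \<beta>) \<notin> hasse D n S) \<alpha>s"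

type_synonym ('a, 'r) tables = "(nat \<Rightarrow> 'a pattern \<Rightarrow> 'r) \<times> (nat \<Rightarrow> 'a pattern \<Rightarrow> 'r)"

text \<open>
  The algorithm runs on the two tables \<open>(M, W)\<close>. All entries are initially \<open>undefined\<close>,
  except for \<open>W 0 (empty_pattern 0)\<close>.
\<close>
definition init_tables :: "('a, 'r::{comm_semiring_0, comm_monoid_mult}) tables" where
  "init_tables = (\<lambda>_ _. undefined, (\<lambda>_ _. undefined)(0 := (\<lambda>_. undefined)(empty_pattern 0 := 1)))"

definition process_node ::
  "'a set \<Rightarrow> nat \<Rightarrow> 'a list set \<Rightarrow> ('a pattern \<Rightarrow> 'r::{comm_semiring_0, comm_monoid_mult})
    \<Rightarrow> ('r \<Rightarrow> 'r \<Rightarrow> 'r) \<Rightarrow> nat \<Rightarrow> 'a pattern \<Rightarrow> ('a, 'r) tables \<Rightarrow> ('a, 'r) tables" where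
  "process_node D n \<Gamma> c ominus s \<alpha> = (\<lambda>(M, W).
    let children = {\<beta>. (\<alpha>, \<beta>) \<in> hasse D n (ending_at (all_patterns D n \<Gamma>) s)};
        m = (if \<alpha> = empty_pattern s then 0
             else suffix_cost D n \<Gamma> c \<alpha> *
               ominus (W (s - 1) (drop_last \<alpha>)) (\<Sum>\<beta>\<in>children. W (s - 1) (drop_last \<beta>)));
        w = m + (\<Sum>\<beta>\<in>children. W s \<beta>)
    in (M(s := (M s)(\<alpha> := m)), W(s := (W s)(\<alpha> := w))))"

text \<open>The argument \<open>ord s\<close> is the list of nodes in the order in which phase \<open>s\<close> visits them.\<close>
definition run_algorithm ::
  "'a set \<Rightarrow> nat \<Rightarrow> 'a list set \<Rightarrow> ('a pattern \<Rightarrow> 'r::{comm_semiring_0, comm_monoid_mult})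
    \<Rightarrow> ('r \<Rightarrow> 'r \<Rightarrow> 'r) \<Rightarrow> (nat \<Rightarrow> 'a pattern list) \<Rightarrow> 'r" where
  "run_algorithm D n \<Gamma> c ominus ord =
    (case fold (\<lambda>s. fold (process_node D n \<Gamma> c ominus s) (ord s)) [1..<n + 1] init_tables of
      (M, W) \<Rightarrow> W n (empty_pattern n))"

text \<open>Leaves-first traversals exist, so quantifying over them is never vacuous.\<close>

lemma finite_patterns:
  assumes "finite D"
  shows "finite (patterns D n)"
proof (rule finite_subset)
  show "patterns D n \<subseteq> ({..n + 1} \<times> {..n}) \<times> {w. set w \<subseteq> D \<and> length w \<le> n}"
    by (auto simp: patterns_def)
  show "finite (({..n + 1} \<times> {..n}) \<times> {w. set w \<subseteq> D \<and> length w \<le> n})"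
    using assms by (simp add: finite_lists_length_le)
qed

lemma leaves_first_exists:
  assumes "finite D"
  shows "\<exists>\<alpha>s. leaves_first D n (ending_at (all_patterns D n \<Gamma>) s) \<alpha>s"
proof -
  let ?S = "ending_at (all_patterns D n \<Gamma>) s"
  have "?S \<subseteq> patterns D n"
    by (auto simp: ending_at_def all_patterns_def empty_pattern_def patterns_def)
  then have "finite ?S"
    using finite_patterns[OF assms] finite_subset by blast
  then obtain xs where xs: "set xs = ?S" "distinct xs"
    using finite_distinct_list by blast
  let ?ys = "rev (sort_key (\<lambda>\<alpha>. length (snd \<alpha>)) xs)"
  have len: "length (snd \<alpha>) < length (snd \<beta>)" if "(\<alpha>, \<beta>) \<in> hasse D n ?S" for \<alpha> \<beta>
  proof -
    from that have "strict_suffix_pattern D n \<alpha> \<beta>"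
      by (simp add: hasse_def)
    then obtain \<gamma> where \<gamma>: "\<gamma> \<in> patterns D n" "is_concat \<gamma> \<alpha> \<beta>" "\<alpha> \<noteq> \<beta>"
      unfolding strict_suffix_pattern_def suffix_pattern_def by blast
    then obtain i j k w v where
      "\<gamma> = ((i, j), w)" "\<alpha> = ((j + 1, k), v)" "\<beta> = ((i, k), w @ v)"
      unfolding is_concat_def by blast
    with \<gamma> show ?thesis
      by (cases w) (simp_all add: patterns_def)
  qed
  have sorted: "sorted_wrt (\<lambda>x y. length (snd y) \<le> length (snd x)) ?ys"
    using sorted_sort_key[of "\<lambda>\<alpha>. length (snd \<alpha>)" xs] by (simp add: sorted_wrt_map sorted_wrt_rev)
  have "sorted_wrt (\<lambda>\<alpha> \<beta>. (\<alpha>, \<beta>) \<notin> hasse D n ?S) ?ys"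
    by (rule sorted_wrt_mono_rel[OF _ sorted]) (use len in \<open>meson leD\<close>)
  moreover have "distinct ?ys" "set ?ys = ?S"
    using xs by simp_all
  ultimately show ?thesis
    unfolding leaves_first_def by blast
qed

end

theory Submission
  imports Defs "HOL-Library.Sublist"
begin

text \<open>
  By induction on \<open>s\<close>, \<open>W s \<alpha>\<close> is the sum of \<open>cost x\<close> over the \<open>x \<in> D\<^sup>1\<^sup>:\<^sup>s\<close> with suffix \<open>\<alpha>\<close>. These \<open>x\<close>
  split into those whose longest suffix in \<open>\<Pi>\<^sub>s\<close> is \<open>\<alpha>\<close> and, disjointly, those with suffix \<open>\<beta>\<close> for
  a child \<open>\<beta>\<close> of \<open>\<alpha>\<close>. On the first part \<open>cost x = \<phi>(\<alpha>) * cost x\<^sup>-\<close>, because every suffix of \<open>x\<close> in \<open>\<Pi>\<degree>\<close>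
  is one of \<open>\<alpha>\<close>. Removing the last letter carries the whole partition to position \<open>s - 1\<close>, where
  it expresses the sum of \<open>cost x\<^sup>-\<close> over the first part as the difference formed by the algorithm.
  For \<open>\<alpha> = \<epsilon>\<^sub>s\<close> the first part is empty, since \<open>D \<subseteq> \<Gamma>\<close> makes the last letter of \<open>x\<close> a longer suffix.
\<close>

section \<open>Suffixes and prefixes of patterns reduced to those of words\<close>

lemma pattern_eqI:
  assumes "\<alpha> \<in> patterns D n" "\<beta> \<in> patterns D n"
    and "snd (fst \<alpha>) = snd (fst \<beta>)" "snd \<alpha> = snd \<beta>"
  shows "\<alpha> = \<beta>"
  using assms by (auto simp: patterns_def)

text \<open>The end and the length of a pattern determine its start, so the suffix order of patterns
  inherits the order properties of \<open>suffix\<close> on words.\<close>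

lemma suffix_pattern_iff:
  assumes x: "x \<in> patterns D n"
  shows "suffix_pattern D n \<alpha> x \<longleftrightarrow>
    \<alpha> \<in> patterns D n \<and> snd (fst \<alpha>) = snd (fst x) \<and> suffix (snd \<alpha>) (snd x)"
proof
  assume "suffix_pattern D n \<alpha> x"
  then show "\<alpha> \<in> patterns D n \<and> snd (fst \<alpha>) = snd (fst x) \<and> suffix (snd \<alpha>) (snd x)"
    using x by (auto simp: suffix_pattern_def is_concat_def patterns_def suffix_def)
next
  assume r: "\<alpha> \<in> patterns D n \<and> snd (fst \<alpha>) = snd (fst x) \<and> suffix (snd \<alpha>) (snd x)"
  obtain i k u where xe: "x = ((i, k), u)" by (metis surj_pair)
  obtain j v where ae: "\<alpha> = ((j, k), v)" using r xe by (metis fst_conv snd_conv surj_pair)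
  obtain w where u: "u = w @ v" using r xe ae by (auto simp: suffix_def)
  \<comment> \<open>The complementary prefix must end right before \<open>j\<close>; starts are at
    least 1, so the subtraction does not truncate.\<close>
  have j: "j = Suc (j - 1)" using r ae by (auto simp: patterns_def)
  have "((i, j - 1), w) \<in> patterns D n"
    using x r xe ae u by (auto simp: patterns_def)
  moreover have "is_concat ((i, j - 1), w) \<alpha> x"
    unfolding is_concat_def xe ae u using j by auto
  ultimately show "suffix_pattern D n \<alpha> x"
    unfolding suffix_pattern_def by blast
qed

lemma prefix_pattern_iff:
  assumes x: "x \<in> patterns D n"
  shows "prefix_pattern D n \<alpha> x \<longleftrightarrow>
    \<alpha> \<in> patterns D n \<and> fst (fst \<alpha>) = fst (fst x) \<and> prefix (snd \<alpha>) (snd x)"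
proof
  assume "prefix_pattern D n \<alpha> x"
  then show "\<alpha> \<in> patterns D n \<and> fst (fst \<alpha>) = fst (fst x) \<and> prefix (snd \<alpha>) (snd x)"
    using x by (auto simp: prefix_pattern_def is_concat_def patterns_def)
next
  assume r: "\<alpha> \<in> patterns D n \<and> fst (fst \<alpha>) = fst (fst x) \<and> prefix (snd \<alpha>) (snd x)"
  obtain i k u where xe: "x = ((i, k), u)" by (metis surj_pair)
  obtain j w where ae: "\<alpha> = ((i, j), w)" using r xe by (metis fst_conv surj_pair)
  obtain v where u: "u = w @ v" using r xe ae by (auto simp: prefix_def)
  have "((j + 1, k), v) \<in> patterns D n"
    using x r xe ae u by (auto simp: patterns_def)
  moreover have "is_concat \<alpha> ((j + 1, k), v) x"
    unfolding is_concat_def xe ae u by auto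
  ultimately show "prefix_pattern D n \<alpha> x"
    unfolding prefix_pattern_def by blast
qed

text \<open>Bracketing an occurrence as (\<gamma>\<beta>)\<delta> makes it a suffix of a prefix, so
  occurrences can be sorted by the prefix in which they end.\<close>

lemma sub_pattern_iff:
  "sub_pattern D n \<beta> x \<longleftrightarrow>
    (\<exists>y\<in>patterns D n. prefix_pattern D n y x \<and> suffix_pattern D n \<beta> y)"
  unfolding sub_pattern_def prefix_pattern_def suffix_pattern_def by blast

lemma suffix_pattern_refl: "x \<in> patterns D n \<Longrightarrow> suffix_pattern D n x x"
  by (simp add: suffix_pattern_iff)

lemma suffix_pattern_trans:
  assumes "suffix_pattern D n \<alpha> \<beta>" "suffix_pattern D n \<beta> x" "x \<in> patterns D n"
  shows "suffix_pattern D n \<alpha> x"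
  using assms suffix_order.trans by (fastforce simp: suffix_pattern_iff)

lemma suffix_pattern_antisym:
  assumes "suffix_pattern D n \<alpha> \<beta>" "suffix_pattern D n \<beta> \<alpha>"
    and "\<alpha> \<in> patterns D n" "\<beta> \<in> patterns D n"
  shows "\<alpha> = \<beta>"
  using assms suffix_order.antisym by (intro pattern_eqI) (auto simp: suffix_pattern_iff)

lemma suffix_pattern_linear:
  assumes "suffix_pattern D n \<alpha> x" "suffix_pattern D n \<beta> x" "x \<in> patterns D n"
  shows "suffix_pattern D n \<alpha> \<beta> \<or> suffix_pattern D n \<beta> \<alpha>"
  using assms suffix_same_cases[of "snd \<alpha>" "snd x" "snd \<beta>"] by (auto simp: suffix_pattern_iff)

section \<open>Removing the last letter\<close>

lemma drop_last_in_patterns: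
  assumes "x \<in> patterns D n" "snd x \<noteq> []"
  shows "drop_last x \<in> patterns D n"
proof -
  obtain i j w where xe: "x = ((i, j), w)" by (metis surj_pair)
  show ?thesis using assms xe
    by (cases w rule: rev_cases) (auto simp: patterns_def drop_last_def)
qed

lemma drop_last_simps:
  "fst (fst (drop_last x)) = fst (fst x)"
  "snd (fst (drop_last x)) = snd (fst x) - 1"
  "snd (drop_last x) = butlast (snd x)"
  by (simp_all add: drop_last_def)

lemma pattern_end_pos:
  assumes "x \<in> patterns D n" "snd x \<noteq> []"
  shows "snd (fst x) \<ge> 1"
  using assms by (cases "snd x") (auto simp: patterns_def)

lemma prefix_pattern_drop_last:
  assumes "x \<in> patterns D n" "snd x \<noteq> []"
  shows "prefix_pattern D n y x \<longleftrightarrow> y = x \<or> prefix_pattern D n y (drop_last x)"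
proof -
  have "prefix (snd y) (snd x) \<longleftrightarrow> snd y = snd x \<or> prefix (snd y) (butlast (snd x))"
    using assms(2) prefix_snoc[of "snd y" "butlast (snd x)" "last (snd x)"] by simp
  \<comment> \<open>Here the starts agree; with equal words the ends agree as well.\<close>
  moreover have "y = x" if "y \<in> patterns D n" "fst (fst y) = fst (fst x)" "snd y = snd x"
    using that assms(1) by (intro pattern_eqI[of y D n x]) (auto simp: patterns_def)
  ultimately show ?thesis
    using assms by (auto simp: prefix_pattern_iff drop_last_in_patterns drop_last_simps)
qed

text \<open>The common last letter gives the direction from left to right, which fails for
  \<open>u = [b]\<close>, \<open>w = [a]\<close> with distinct letters.\<close>

lemma suffix_butlast_iff:
  assumes "suffix [a] u" "suffix [a] w"
  shows "suffix (butlast u) (butlast w) \<longleftrightarrow> suffix u w"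
proof -
  obtain u' where u: "u = u' @ [a]" using assms(1) by (auto simp: suffix_def)
  obtain w' where w: "w = w' @ [a]" using assms(2) by (auto simp: suffix_def)
  show ?thesis by (auto simp: u w suffix_def)
qed

text \<open>The role of \<alpha> is to fix the last letter: as a non-empty suffix of both x and
  \<beta>, it forces them to end alike.\<close>

lemma suffix_pattern_drop_last:
  assumes "suffix_pattern D n \<alpha> x" "x \<in> patterns D n" "snd \<alpha> \<noteq> []" "suffix_pattern D n \<alpha> \<beta>"
    and "\<beta> \<in> patterns D n"
  shows "suffix_pattern D n (drop_last \<beta>) (drop_last x) \<longleftrightarrow> suffix_pattern D n \<beta> x"
proof -
  have a: "suffix [last (snd \<alpha>)] (snd \<alpha>)"
    using assms(3) by (metis append_butlast_last_id suffixI)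
  have "suffix (snd \<alpha>) (snd x)" "suffix (snd \<alpha>) (snd \<beta>)"
    using assms by (auto simp: suffix_pattern_iff)
  then have "suffix [last (snd \<alpha>)] (snd x)" "suffix [last (snd \<alpha>)] (snd \<beta>)"
    using a suffix_order.trans by blast+
  moreover from this have "snd x \<noteq> []" "snd \<beta> \<noteq> []" by auto
  moreover have "snd (fst x) = snd (fst \<beta>)" using assms by (auto simp: suffix_pattern_iff)
  ultimately show ?thesis
    using assms by (auto simp: suffix_pattern_iff drop_last_in_patterns drop_last_simps
        suffix_butlast_iff)
qed

definition snoc_pattern :: "'a pattern \<Rightarrow> 'a \<Rightarrow> 'a pattern" where
  "snoc_pattern y a = ((fst (fst y), snd (fst y) + 1), snd y @ [a])"

lemma drop_last_snoc_pattern [simp]: "drop_last (snoc_pattern y a) = y"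
  by (simp add: drop_last_def snoc_pattern_def)

lemma patterns_on_iff:
  "x \<in> patterns_on D n (Suc 0) s \<longleftrightarrow> s \<le> n \<and> (\<exists>w. x = ((Suc 0, s), w) \<and> length w = s \<and> set w \<subseteq> D)"
  by (auto simp: patterns_on_def patterns_def)

text \<open>A non-empty suffix \<beta> prescribes the last letter of x, so x is recovered from
  \<open>drop_last x\<close> by appending \<open>last (snd \<beta>)\<close>.\<close>

lemma bij_betw_drop_last:
  assumes "\<beta> \<in> patterns D n" "snd (fst \<beta>) = s" "snd \<beta> \<noteq> []"
  shows "bij_betw drop_last {x \<in> patterns_on D n 1 s. suffix_pattern D n \<beta> x}
    {y \<in> patterns_on D n 1 (s - 1). suffix_pattern D n (drop_last \<beta>) y}"
proof -
  let ?a = "last (snd \<beta>)"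
  have s: "s \<ge> 1" "s \<le> n" using pattern_end_pos[OF assms(1,3)] assms by (auto simp: patterns_def)
  have ldec: "suffix [?a] (snd \<beta>)"
    using assms(3) by (metis append_butlast_last_id suffixI)
  have aD: "?a \<in> D" using assms(1,3) last_in_set by (fastforce simp: patterns_def)
  have on: "x \<in> patterns D n" if "x \<in> patterns_on D n i j" for x i j
    using that by (simp add: patterns_on_def)
  have fwd: "drop_last x \<in> patterns_on D n 1 (s - 1)" if "x \<in> patterns_on D n 1 s" for x
    using that s by (auto simp: patterns_on_iff drop_last_def dest!: in_set_butlastD)
  have bwd: "snoc_pattern y ?a \<in> patterns_on D n 1 s" if "y \<in> patterns_on D n 1 (s - 1)" for y
    using that s aD by (auto simp: patterns_on_iff snoc_pattern_def)
  have snoc: "snoc_pattern (drop_last x) ?a = x"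
    if "x \<in> patterns_on D n 1 s" "suffix_pattern D n \<beta> x" for x
  proof -
    have "suffix [?a] (snd x)"
      using that on ldec suffix_order.trans by (fastforce simp: suffix_pattern_iff)
    then show ?thesis
      using that s by (auto simp: patterns_on_iff snoc_pattern_def drop_last_def suffix_def)
  qed
  have suf: "suffix_pattern D n \<beta> (snoc_pattern y ?a)"
    if "y \<in> patterns_on D n 1 (s - 1)" "suffix_pattern D n (drop_last \<beta>) y" for y
  proof -
    have "suffix (butlast (snd \<beta>)) (butlast (snd (snoc_pattern y ?a)))"
      using that on by (simp add: suffix_pattern_iff drop_last_simps snoc_pattern_def)
    moreover have "suffix [?a] (snd (snoc_pattern y ?a))"
      by (simp add: snoc_pattern_def suffix_def)
    ultimately have "suffix (snd \<beta>) (snd (snoc_pattern y ?a))"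
      using suffix_butlast_iff[OF ldec] by blast
    then show ?thesis
      using on[OF bwd[OF that(1)]] bwd[OF that(1)] assms
      by (simp add: suffix_pattern_iff patterns_on_def)
  qed
  have sufd: "suffix_pattern D n (drop_last \<beta>) (drop_last x)"
    if "x \<in> patterns_on D n 1 s" "suffix_pattern D n \<beta> x" for x
    using suffix_pattern_drop_last[OF that(2) on[OF that(1)] assms(3)] that(2)
      suffix_pattern_refl[OF assms(1)] assms(1) by blast
  show ?thesis
    by (rule bij_betw_byWitness[where f' = "\<lambda>y. snoc_pattern y ?a"])
      (use fwd bwd snoc suf sufd in auto)
qed

section \<open>Nodes of the suffix tree and the patterns extending them\<close>

locale alphabet_words =
  fixes D :: "'a set" and n :: nat and \<Gamma> :: "'a list set"
  assumes finite_D: "finite D"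
    and words: "\<And>w. w \<in> \<Gamma> \<Longrightarrow> w \<noteq> [] \<and> set w \<subseteq> D"
    and letters: "\<And>a. a \<in> D \<Longrightarrow> [a] \<in> \<Gamma>"
begin

abbreviation nodes :: "nat \<Rightarrow> 'a pattern set" where
  "nodes s \<equiv> ending_at (all_patterns D n \<Gamma>) s"

abbreviation children :: "nat \<Rightarrow> 'a pattern \<Rightarrow> 'a pattern set" where
  "children s \<alpha> \<equiv> {\<beta>. (\<alpha>, \<beta>) \<in> hasse D n (nodes s)}"

definition extensions :: "nat \<Rightarrow> 'a pattern \<Rightarrow> 'a pattern set" where
  "extensions s \<alpha> = {x \<in> patterns_on D n 1 s. suffix_pattern D n \<alpha> x}"

text \<open>The suffixes of x form a chain, so for a node \<alpha> this says that \<alpha> is the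
  longest node that is a suffix of x.\<close>

definition max_extensions :: "nat \<Rightarrow> 'a pattern \<Rightarrow> 'a pattern set" where
  "max_extensions s \<alpha> =
    {x \<in> extensions s \<alpha>. \<forall>\<beta>\<in>nodes s. suffix_pattern D n \<beta> x \<longrightarrow> suffix_pattern D n \<beta> \<alpha>}"

lemma empty_pattern_in_patterns: "s \<le> n \<Longrightarrow> empty_pattern s \<in> patterns D n"
  by (simp add: empty_pattern_def patterns_def)

lemma nodes_patterns: "\<alpha> \<in> nodes s \<Longrightarrow> \<alpha> \<in> patterns D n \<and> snd (fst \<alpha>) = s"
  by (auto simp: ending_at_def all_patterns_def empty_pattern_in_patterns)

lemma extensions_patterns: "x \<in> extensions s \<alpha> \<Longrightarrow> x \<in> patterns D n"
  by (simp add: extensions_def patterns_on_def)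

lemma max_extensions_patterns: "x \<in> max_extensions s \<alpha> \<Longrightarrow> x \<in> patterns D n"
  using extensions_patterns unfolding max_extensions_def by blast

lemma finite_extensions: "finite (extensions s \<alpha>)"
  by (rule finite_subset[OF _ finite_patterns[OF finite_D]]) (auto intro: extensions_patterns)

lemma finite_children: "finite (children s \<alpha>)"
  by (rule finite_subset[OF _ finite_patterns[OF finite_D]])
    (auto simp: hasse_def dest: nodes_patterns)

lemma base_in_patterns: "\<beta> \<in> base_patterns n \<Gamma> \<Longrightarrow> \<beta> \<in> patterns D n \<and> snd \<beta> \<noteq> []"
  using words by (auto simp: base_patterns_def patterns_def)

lemma finite_base: "finite (base_patterns n \<Gamma>)"
  by (rule finite_subset[OF _ finite_patterns[OF finite_D]]) (use base_in_patterns in auto)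

text \<open>Every pattern is a prefix of itself. Hence maximality among nodes also controls the
  suffixes in \<Pi>\<degree>.\<close>

lemma base_in_nodes: "\<beta> \<in> base_patterns n \<Gamma> \<Longrightarrow> \<beta> \<in> nodes (snd (fst \<beta>))"
  using base_in_patterns[of \<beta>] prefix_pattern_iff[of \<beta> D n \<beta>]
  by (auto simp: ending_at_def all_patterns_def)

lemma nonempty_node_iff:
  assumes "\<alpha> \<in> nodes s" shows "snd \<alpha> \<noteq> [] \<longleftrightarrow> \<alpha> \<noteq> empty_pattern s"
  using nodes_patterns[OF assms] by (auto simp: patterns_def empty_pattern_def)

text \<open>\<Pi> is closed under prefixes. This ensures that the entries of row
  \<open>s - 1\<close> read in phase \<open>s\<close> belong to nodes.\<close>

lemma drop_last_node:
  assumes "\<alpha> \<in> nodes s" "snd \<alpha> \<noteq> []"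
  shows "drop_last \<alpha> \<in> nodes (s - 1)"
proof -
  have p: "\<alpha> \<in> patterns D n" "snd (fst \<alpha>) = s" using nodes_patterns[OF assms(1)] by auto
  from assms obtain \<beta> where b: "\<beta> \<in> base_patterns n \<Gamma>" "prefix_pattern D n \<alpha> \<beta>"
    by (auto simp: ending_at_def all_patterns_def empty_pattern_def)
  have "prefix_pattern D n (drop_last \<alpha>) \<beta>"
    using b base_in_patterns[OF b(1)] drop_last_in_patterns[OF p(1) assms(2)]
      prefix_order.trans[OF prefixeq_butlast, of "snd \<alpha>" "snd \<beta>"]
    by (simp add: prefix_pattern_iff drop_last_simps)
  then show ?thesis
    using b drop_last_in_patterns[OF p(1) assms(2)] p(2)
    by (auto simp: ending_at_def all_patterns_def drop_last_simps)
qed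

section \<open>Partition of the extensions of a node\<close>

text \<open>A shortest node strictly above \<alpha> and below \<beta> is a child of
  \<alpha>.\<close>

lemma child_between:
  assumes "\<alpha> \<in> nodes s" "\<beta> \<in> nodes s" "strict_suffix_pattern D n \<alpha> \<beta>"
  obtains \<gamma> where "\<gamma> \<in> children s \<alpha>" "suffix_pattern D n \<gamma> \<beta>"
proof -
  let ?P = "\<lambda>\<gamma>. \<gamma> \<in> nodes s \<and> strict_suffix_pattern D n \<alpha> \<gamma> \<and> suffix_pattern D n \<gamma> \<beta>"
  have "?P \<beta>" using assms nodes_patterns suffix_pattern_refl by blast
  then obtain \<gamma> where g: "?P \<gamma>" "\<And>\<delta>. ?P \<delta> \<Longrightarrow> length (snd \<gamma>) \<le> length (snd \<delta>)"
    using ex_has_least_nat[of ?P \<beta> "\<lambda>\<gamma>. length (snd \<gamma>)"] by blast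
  \<comment> \<open>An intermediate \<delta> would satisfy \<open>?P\<close> too, hence be at least
    as long as \<gamma>, although it is a proper suffix of it.\<close>
  have False if d: "\<delta> \<in> nodes s" "strict_suffix_pattern D n \<alpha> \<delta>" "strict_suffix_pattern D n \<delta> \<gamma>" for \<delta>
  proof -
    have pp: "\<delta> \<in> patterns D n" "\<gamma> \<in> patterns D n" "\<beta> \<in> patterns D n"
      using d g assms nodes_patterns by blast+
    have "suffix_pattern D n \<delta> \<beta>"
      using d(3) g(1) pp suffix_pattern_trans unfolding strict_suffix_pattern_def by blast
    then have le: "length (snd \<gamma>) \<le> length (snd \<delta>)" using g(2) d by blast
    have sf: "suffix (snd \<delta>) (snd \<gamma>)" "snd (fst \<delta>) = snd (fst \<gamma>)"
      using d(3) pp by (auto simp: strict_suffix_pattern_def suffix_pattern_iff)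
    then have "snd \<delta> = snd \<gamma>" using le by (auto simp: suffix_def)
    then have "\<delta> = \<gamma>" using sf pp by (intro pattern_eqI) auto
    then show False using d(3) by (simp add: strict_suffix_pattern_def)
  qed
  then have "\<gamma> \<in> children s \<alpha>" using g assms by (auto simp: hasse_def)
  then show thesis using g that by blast
qed

text \<open>If \<alpha> is not the longest node that is a suffix of x, a longer one exists; it lies
  above \<alpha> by linearity, and the child of \<alpha> on the way to it is a suffix of x.\<close>

lemma extensions_split:
  assumes \<alpha>: "\<alpha> \<in> nodes s"
  shows "extensions s \<alpha> = max_extensions s \<alpha> \<union> (\<Union>\<beta>\<in>children s \<alpha>. extensions s \<beta>)"
proof (intro equalityI subsetI)
  fix x assume x: "x \<in> extensions s \<alpha>"
  then have xp: "x \<in> patterns D n" by (rule extensions_patterns)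
  show "x \<in> max_extensions s \<alpha> \<union> (\<Union>\<beta>\<in>children s \<alpha>. extensions s \<beta>)"
  proof (cases "x \<in> max_extensions s \<alpha>")
    case False
    then obtain \<beta> where b: "\<beta> \<in> nodes s" "suffix_pattern D n \<beta> x" "\<not> suffix_pattern D n \<beta> \<alpha>"
      using x by (auto simp: max_extensions_def)
    have "strict_suffix_pattern D n \<alpha> \<beta>"
      using suffix_pattern_linear[OF b(2) _ xp, of \<alpha>] x b
      by (auto simp: strict_suffix_pattern_def extensions_def)
    then obtain \<gamma> where g: "\<gamma> \<in> children s \<alpha>" "suffix_pattern D n \<gamma> \<beta>"
      using child_between[OF \<alpha> b(1)] by blast
    have "suffix_pattern D n \<gamma> x" using suffix_pattern_trans[OF g(2) b(2) xp] .
    then have "x \<in> extensions s \<gamma>" using x by (simp add: extensions_def)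
    then show ?thesis using g(1) by blast
  qed simp
next
  fix x assume "x \<in> max_extensions s \<alpha> \<union> (\<Union>\<beta>\<in>children s \<alpha>. extensions s \<beta>)"
  then consider "x \<in> max_extensions s \<alpha>"
    | \<beta> where "\<beta> \<in> children s \<alpha>" "x \<in> extensions s \<beta>" by blast
  then show "x \<in> extensions s \<alpha>"
  proof cases
    case 2
    then have "suffix_pattern D n \<alpha> \<beta>" "suffix_pattern D n \<beta> x" "x \<in> patterns_on D n 1 s"
      by (simp_all add: hasse_def strict_suffix_pattern_def extensions_def)
    then show ?thesis
      using suffix_pattern_trans extensions_patterns[OF 2(2)] unfolding extensions_def by blast
  qed (simp add: max_extensions_def)
qed

text \<open>By maximality such a child would be a suffix of \<alpha>, contradicting
  antisymmetry.\<close>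

lemma max_extensions_disjoint:
  "max_extensions s \<alpha> \<inter> (\<Union>\<beta>\<in>children s \<alpha>. extensions s \<beta>) = {}"
proof -
  have False if "x \<in> max_extensions s \<alpha>" "\<beta> \<in> children s \<alpha>" "x \<in> extensions s \<beta>" for x \<beta>
  proof -
    have "\<beta> \<in> nodes s" "\<alpha> \<in> nodes s" "suffix_pattern D n \<alpha> \<beta>" "\<alpha> \<noteq> \<beta>"
      using that(2) by (auto simp: hasse_def strict_suffix_pattern_def)
    moreover from this have "suffix_pattern D n \<beta> \<alpha>"
      using that by (auto simp: max_extensions_def extensions_def)
    ultimately show False using suffix_pattern_antisym nodes_patterns by metis
  qed
  then show ?thesis by blast
qed

text \<open>Suffixes of one x are comparable, so one child would lie strictly between \<alpha> and
  the other, which the Hasse diagram forbids.\<close>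

lemma children_disjoint:
  assumes "\<beta> \<in> children s \<alpha>" "\<gamma> \<in> children s \<alpha>" "\<beta> \<noteq> \<gamma>"
  shows "extensions s \<beta> \<inter> extensions s \<gamma> = {}"
proof -
  have False if "x \<in> extensions s \<beta>" "x \<in> extensions s \<gamma>" for x
    using suffix_pattern_linear[of D n \<beta> x \<gamma>] that extensions_patterns[OF that(1)] assms
    unfolding extensions_def hasse_def strict_suffix_pattern_def by blast
  then show ?thesis by blast
qed

text \<open>The summand is left general because the recursion splits both the sum of
  \<open>cost x\<close> and that of \<open>cost (drop_last x)\<close>.\<close>

lemma sum_extensions_split:
  fixes g :: "'a pattern \<Rightarrow> 'b::comm_monoid_add"
  assumes "\<alpha> \<in> nodes s"
  shows "sum g (extensions s \<alpha>) =
    sum g (max_extensions s \<alpha>) + (\<Sum>\<beta>\<in>children s \<alpha>. sum g (extensions s \<beta>))"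
proof -
  have "finite (max_extensions s \<alpha>)"
    using finite_extensions by (simp add: max_extensions_def)
  moreover have "sum g (\<Union>\<beta>\<in>children s \<alpha>. extensions s \<beta>) =
      (\<Sum>\<beta>\<in>children s \<alpha>. sum g (extensions s \<beta>))"
    by (intro sum.UNION_disjoint finite_children ballI impI finite_extensions)
      (use children_disjoint in blast)
  ultimately show ?thesis
    unfolding extensions_split[OF assms]
    using max_extensions_disjoint finite_extensions finite_children
    by (subst sum.union_disjoint) auto
qed

lemma sum_extensions_drop_last:
  assumes "\<beta> \<in> nodes s" "snd \<beta> \<noteq> []"
  shows "(\<Sum>x\<in>extensions s \<beta>. g (drop_last x)) = sum g (extensions (s - 1) (drop_last \<beta>))"
  unfolding extensions_def
  by (rule sum.reindex_bij_betw[OF bij_betw_drop_last]) (use nodes_patterns assms in auto)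

lemma max_extensions_empty:
  assumes "1 \<le> s"
  shows "max_extensions s (empty_pattern s) = {}"
proof -
  have False if x: "x \<in> max_extensions s (empty_pattern s)" for x
  proof -
    have xp: "x \<in> patterns D n" using x by (rule max_extensions_patterns)
    obtain w where w: "x = ((1, s), w)" "length w = s" "set w \<subseteq> D" "s \<le> n"
      using x by (auto simp: max_extensions_def extensions_def patterns_on_iff)
    then have ne: "w \<noteq> []" using assms by auto
    \<comment> \<open>The one-letter pattern at position \<open>s\<close> is a node by
      \<open>letters\<close>, and a suffix of x that is too long to be a suffix of the empty
      pattern.\<close>
    let ?b = "((s, s), [last w])"
    have b: "?b \<in> base_patterns n \<Gamma>"
      using w ne assms letters last_in_set by (fastforce simp: base_patterns_def)
    have "suffix [last w] w" using ne by (metis append_butlast_last_id suffixI)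
    then have "suffix_pattern D n ?b x"
      using xp w base_in_patterns[OF b] by (simp add: suffix_pattern_iff)
    then have "suffix_pattern D n ?b (empty_pattern s)"
      using x base_in_nodes[OF b] by (simp add: max_extensions_def)
    then show False
      using empty_pattern_in_patterns[OF w(4)] by (simp add: suffix_pattern_iff empty_pattern_def)
  qed
  then show ?thesis by blast
qed

section \<open>Factorization of the cost\<close>

text \<open>The occurrences in x are split by where they end: at the end of x, or already inside
  \<open>drop_last x\<close>.\<close>

lemma cost_drop_last:
  assumes x: "x \<in> patterns D n" "snd x \<noteq> []"
  shows "cost D n \<Gamma> c x = suffix_cost D n \<Gamma> c x * cost D n \<Gamma> c (drop_last x)"
proof -
  let ?A = "{\<beta> \<in> base_patterns n \<Gamma>. suffix_pattern D n \<beta> x}"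
  let ?B = "{\<beta> \<in> base_patterns n \<Gamma>. sub_pattern D n \<beta> (drop_last x)}"
  have "sub_pattern D n \<beta> x \<longleftrightarrow> suffix_pattern D n \<beta> x \<or> sub_pattern D n \<beta> (drop_last x)" for \<beta>
    using x unfolding sub_pattern_iff by (auto simp: prefix_pattern_drop_last)
  then have "{\<beta> \<in> base_patterns n \<Gamma>. sub_pattern D n \<beta> x} = ?A \<union> ?B" by auto
  moreover have "?A \<inter> ?B = {}"
  proof -
    \<comment> \<open>If \<beta> were of both kinds, y would share the start and the end of x and
      still be shorter.\<close>
    have False if "suffix_pattern D n \<beta> x" "y \<in> patterns D n"
      "prefix_pattern D n y (drop_last x)" "suffix_pattern D n \<beta> y" for \<beta> y
    proof -
      have "prefix (snd y) (butlast (snd x))" "fst (fst y) = fst (fst x)"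
        using that drop_last_in_patterns[OF x] by (auto simp: prefix_pattern_iff drop_last_simps)
      then have "length (snd y) < length (snd x)"
        using x(2) prefix_length_le[of "snd y" "butlast (snd x)"]
        by (simp add: le_less_trans)
      moreover have "snd (fst y) = snd (fst x)" using that x by (auto simp: suffix_pattern_iff)
      ultimately show False
        using \<open>fst (fst y) = fst (fst x)\<close> that(2) x(1) by (auto simp: patterns_def)
    qed
    then show ?thesis by (auto simp: sub_pattern_iff)
  qed
  ultimately show ?thesis
    unfolding cost_def suffix_cost_def using finite_base by (simp add: prod.union_disjoint)
qed

text \<open>Both products have the same index set: a base pattern that is a suffix of x is a node at
  \<open>s\<close>, so maximality applies to it.\<close>

lemma suffix_cost_max_extension:
  assumes "\<alpha> \<in> nodes s" "x \<in> max_extensions s \<alpha>"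
  shows "suffix_cost D n \<Gamma> c x = suffix_cost D n \<Gamma> c \<alpha>"
proof -
  have xp: "x \<in> patterns D n" "suffix_pattern D n \<alpha> x"
    using assms max_extensions_patterns by (auto simp: max_extensions_def extensions_def)
  have "suffix_pattern D n \<beta> x \<longleftrightarrow> suffix_pattern D n \<beta> \<alpha>" if "\<beta> \<in> base_patterns n \<Gamma>" for \<beta>
  proof
    assume b: "suffix_pattern D n \<beta> x"
    then have "snd (fst \<beta>) = s"
      using xp nodes_patterns[OF assms(1)] by (simp add: suffix_pattern_iff)
    then have "\<beta> \<in> nodes s" using base_in_nodes[OF that] by simp
    then show "suffix_pattern D n \<beta> \<alpha>" using b assms(2) by (simp add: max_extensions_def)
  qed (use suffix_pattern_trans xp in blast)
  then show ?thesis unfolding suffix_cost_def by (intro prod.cong) auto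
qed

section \<open>The recursion for the table entries\<close>

text \<open>The intended final value of \<open>W s \<alpha>\<close>.\<close>

definition suffix_sum ::
  "('a pattern \<Rightarrow> 'r::{comm_semiring_0, comm_monoid_mult}) \<Rightarrow> nat \<Rightarrow> 'a pattern \<Rightarrow> 'r" where
  "suffix_sum c s \<alpha> = sum (cost D n \<Gamma> c) (extensions s \<alpha>)"

text \<open>The right-hand side has the shape of the update in \<open>process_node\<close>, with the
  table entries replaced by their intended values.\<close>

lemma suffix_sum_recursion:
  fixes c :: "'a pattern \<Rightarrow> 'r::{comm_semiring_0, comm_monoid_mult}"
  assumes ominus: "\<And>a b. ominus a b + b = (a::'r)"
    and \<alpha>: "\<alpha> \<in> nodes s" and s: "1 \<le> s"
  shows "suffix_sum c s \<alpha> =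
    (if \<alpha> = empty_pattern s then 0
     else suffix_cost D n \<Gamma> c \<alpha> * ominus (suffix_sum c (s - 1) (drop_last \<alpha>))
       (\<Sum>\<beta>\<in>children s \<alpha>. suffix_sum c (s - 1) (drop_last \<beta>)))
    + (\<Sum>\<beta>\<in>children s \<alpha>. suffix_sum c s \<beta>)"
proof (cases "\<alpha> = empty_pattern s")
  case True
  then show ?thesis
    using sum_extensions_split[OF \<alpha>, of "cost D n \<Gamma> c"] max_extensions_empty[OF s]
    by (simp add: suffix_sum_def)
next
  case False
  then have ne: "snd \<alpha> \<noteq> []" using nonempty_node_iff[OF \<alpha>] by simp
  \<comment> \<open>The assumption on \<open>ominus\<close> makes \<open>ominus 0 b\<close> an
    additive inverse of \<open>b\<close>, so addition is cancellative.\<close>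
  have cancel: "a = ominus (a + b) b" for a b :: 'r
    by (metis ominus add.assoc add.commute add.left_neutral)
  have child: "\<beta> \<in> nodes s" "snd \<beta> \<noteq> []" if "\<beta> \<in> children s \<alpha>" for \<beta>
  proof -
    show "\<beta> \<in> nodes s" using that by (simp add: hasse_def)
    then show "snd \<beta> \<noteq> []"
      using that ne nodes_patterns by (auto simp: hasse_def strict_suffix_pattern_def suffix_pattern_iff)
  qed
  let ?g = "\<lambda>x. cost D n \<Gamma> c (drop_last x)"
  \<comment> \<open>The partition is applied at position \<open>s\<close> to the cost of
    \<open>drop_last x\<close>; the bijection \<open>drop_last\<close> then moves every sum over
    extensions to position \<open>s - 1\<close>.\<close>
  have "suffix_sum c (s - 1) (drop_last \<alpha>) =
      sum ?g (max_extensions s \<alpha>) + (\<Sum>\<beta>\<in>children s \<alpha>. suffix_sum c (s - 1) (drop_last \<beta>))"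
    unfolding suffix_sum_def
    using sum_extensions_split[OF \<alpha>, of ?g] child
    by (simp add: sum_extensions_drop_last[OF \<alpha> ne] sum_extensions_drop_last)
  then have diff: "ominus (suffix_sum c (s - 1) (drop_last \<alpha>))
      (\<Sum>\<beta>\<in>children s \<alpha>. suffix_sum c (s - 1) (drop_last \<beta>)) = sum ?g (max_extensions s \<alpha>)"
    using cancel by simp
  have "cost D n \<Gamma> c x = suffix_cost D n \<Gamma> c \<alpha> * ?g x" if x: "x \<in> max_extensions s \<alpha>" for x
  proof -
    have "snd x \<noteq> []"
      using x s by (auto simp: max_extensions_def extensions_def patterns_on_iff)
    then show ?thesis
      using cost_drop_last[OF max_extensions_patterns[OF x]] suffix_cost_max_extension[OF \<alpha> x] by metis
  qed
  then have "sum (cost D n \<Gamma> c) (max_extensions s \<alpha>) =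
      suffix_cost D n \<Gamma> c \<alpha> * sum ?g (max_extensions s \<alpha>)"
    by (simp add: sum_distrib_left)
  then show ?thesis
    using sum_extensions_split[OF \<alpha>, of "cost D n \<Gamma> c"] False
    unfolding diff by (simp add: suffix_sum_def)
qed

section \<open>Correctness of the traversal and of the phases\<close>

text \<open>Invariant inside phase \<open>s\<close>: row \<open>s - 1\<close> of \<open>W\<close>
  stays correct on its nodes, and row \<open>s\<close> is correct on the visited nodes
  \<open>xs\<close>. The pending nodes \<open>ys\<close> occur so that the order of the whole
  traversal remains available; the induction moves \<alpha> from \<open>xs\<close> to
  \<open>ys\<close>.\<close>

lemma fold_process_node:
  fixes c :: "'a pattern \<Rightarrow> 'r::{comm_semiring_0, comm_monoid_mult}"
  assumes ominus: "\<And>a b. ominus a b + b = (a::'r)" and s: "1 \<le> s"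
    and W: "\<forall>\<alpha>\<in>nodes (s - 1). snd T (s - 1) \<alpha> = suffix_sum c (s - 1) \<alpha>"
    and sorted: "sorted_wrt (\<lambda>\<alpha> \<beta>. (\<alpha>, \<beta>) \<notin> hasse D n (nodes s)) (xs @ ys)"
    and nodes: "set (xs @ ys) = nodes s"
    and \<gamma>: "t = s \<and> \<gamma> \<in> set xs \<or> t = s - 1 \<and> \<gamma> \<in> nodes t"
  shows "snd (fold (process_node D n \<Gamma> c ominus s) xs T) t \<gamma> = suffix_sum c t \<gamma>"
  using sorted nodes \<gamma>
proof (induction xs arbitrary: ys t \<gamma> rule: rev_induct)
  case Nil
  then show ?case using W by auto
next
  case (snoc \<alpha> xs)
  obtain M' W' where T': "fold (process_node D n \<Gamma> c ominus s) xs T = (M', W')"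
    by fastforce
  have IH: "W' t \<beta> = suffix_sum c t \<beta>"
    if "t = s \<and> \<beta> \<in> set xs \<or> t = s - 1 \<and> \<beta> \<in> nodes t" for t \<beta>
    using snoc.IH[of "\<alpha> # ys" t \<beta>] snoc.prems that unfolding T' by simp
  have \<alpha>: "\<alpha> \<in> nodes s" using snoc.prems by auto
  have ch: "\<beta> \<in> nodes s" "snd \<beta> \<noteq> []" "\<beta> \<in> set xs" if b: "\<beta> \<in> children s \<alpha>" for \<beta>
  proof -
    show bn: "\<beta> \<in> nodes s" using b by (simp add: hasse_def)
    have "suffix_pattern D n \<alpha> \<beta>" "\<alpha> \<noteq> \<beta>" using b by (auto simp: hasse_def strict_suffix_pattern_def)
    \<comment> \<open>An empty \<beta> would have only itself as a suffix, forcing \<alpha> =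
      \<beta>.\<close>
    then show "snd \<beta> \<noteq> []"
      using nodes_patterns[OF \<alpha>] nodes_patterns[OF bn] pattern_eqI[of \<alpha> D n \<beta>]
      by (auto simp: suffix_pattern_iff)
    \<comment> \<open>The leaves-first order excludes children of \<alpha> from the pending
      nodes.\<close>
    show "\<beta> \<in> set xs"
      using snoc.prems bn \<open>\<alpha> \<noteq> \<beta>\<close> b by (auto simp: sorted_wrt_append)
  qed
  have new: "(if \<alpha> = empty_pattern s then 0
      else suffix_cost D n \<Gamma> c \<alpha> * ominus (W' (s - 1) (drop_last \<alpha>))
        (\<Sum>\<beta>\<in>children s \<alpha>. W' (s - 1) (drop_last \<beta>))) + (\<Sum>\<beta>\<in>children s \<alpha>. W' s \<beta>)
    = suffix_sum c s \<alpha>"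
  proof -
    have "(\<Sum>\<beta>\<in>children s \<alpha>. W' (s - 1) (drop_last \<beta>)) =
        (\<Sum>\<beta>\<in>children s \<alpha>. suffix_sum c (s - 1) (drop_last \<beta>))"
      by (intro sum.cong refl IH) (use ch drop_last_node in blast)
    moreover have "(\<Sum>\<beta>\<in>children s \<alpha>. W' s \<beta>) = (\<Sum>\<beta>\<in>children s \<alpha>. suffix_sum c s \<beta>)"
      by (intro sum.cong refl IH) (use ch in blast)
    \<comment> \<open>For the empty pattern \<open>drop_last\<close> yields no pattern; the update
      does not use that entry then.\<close>
    moreover have "W' (s - 1) (drop_last \<alpha>) = suffix_sum c (s - 1) (drop_last \<alpha>)"
      if "\<alpha> \<noteq> empty_pattern s"
      using IH drop_last_node[OF \<alpha>] nonempty_node_iff[OF \<alpha>] that by blast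
    ultimately show ?thesis
      unfolding suffix_sum_recursion[where ominus = ominus, OF ominus \<alpha> s] by simp
  qed
  have step: "fold (process_node D n \<Gamma> c ominus s) (xs @ [\<alpha>]) T =
      process_node D n \<Gamma> c ominus s \<alpha> (M', W')"
    by (simp add: T')
  show ?case
  proof (cases "t = s \<and> \<gamma> = \<alpha>")
    case True
    then show ?thesis using new unfolding step by (simp add: process_node_def Let_def)
  next
    case False
    then have "W' t \<gamma> = suffix_sum c t \<gamma>" by (intro IH) (use snoc.prems(3) in auto)
    then show ?thesis using False unfolding step by (auto simp: process_node_def Let_def)
  qed
qed

text \<open>A statement about row \<open>s\<close> alone suffices for the induction, since the next
  phase reads only this row and the one it fills.\<close>

lemma fold_phases:
  fixes c :: "'a pattern \<Rightarrow> 'r::{comm_semiring_0, comm_monoid_mult}"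
  assumes ominus: "\<And>a b. ominus a b + b = (a::'r)"
    and ord: "\<And>s. 1 \<le> s \<Longrightarrow> s \<le> n \<Longrightarrow> leaves_first D n (nodes s) (ord s)"
    and "s \<le> n"
  shows "\<forall>\<alpha>\<in>nodes s.
    snd (fold (\<lambda>s. fold (process_node D n \<Gamma> c ominus s) (ord s)) [1..<s + 1] init_tables) s \<alpha>
      = suffix_sum c s \<alpha>"
  using \<open>s \<le> n\<close>
proof (induction s)
  case 0
  \<comment> \<open>Starts are at least 1, so only the empty pattern ends at 0, and the single
    initialized entry covers row 0.\<close>
  have "\<alpha> = empty_pattern 0" if "\<alpha> \<in> nodes 0" for \<alpha> :: "'a pattern"
    using nodes_patterns[OF that] by (auto simp: patterns_def empty_pattern_def)
  moreover have "extensions 0 (empty_pattern 0) = {empty_pattern 0}"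
    using suffix_pattern_refl[OF empty_pattern_in_patterns[of 0]]
    by (auto simp: extensions_def patterns_on_iff empty_pattern_def)
  moreover have "cost D n \<Gamma> c (empty_pattern 0) = 1"
  proof -
    have "\<not> sub_pattern D n \<beta> (empty_pattern 0)" if "\<beta> \<in> base_patterns n \<Gamma>" for \<beta>
      using base_in_patterns[OF that] empty_pattern_in_patterns[of 0]
      by (auto simp: sub_pattern_iff prefix_pattern_iff suffix_pattern_iff empty_pattern_def)
    then have "{\<beta> \<in> base_patterns n \<Gamma>. sub_pattern D n \<beta> (empty_pattern 0)} = {}" by blast
    then show ?thesis unfolding cost_def by (simp only: prod.empty)
  qed
  ultimately show ?case
    by (auto simp: suffix_sum_def init_tables_def)
next
  case (Suc s)
  let ?T = "fold (\<lambda>s. fold (process_node D n \<Gamma> c ominus s) (ord s)) [1..<s + 1] init_tables"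
  from Suc have "\<forall>\<alpha>\<in>nodes (Suc s - 1). snd ?T (Suc s - 1) \<alpha> = suffix_sum c (Suc s - 1) \<alpha>"
    by simp
  moreover have "sorted_wrt (\<lambda>\<alpha> \<beta>. (\<alpha>, \<beta>) \<notin> hasse D n (nodes (Suc s))) (ord (Suc s) @ [])"
    "set (ord (Suc s) @ []) = nodes (Suc s)"
    using ord[of "Suc s"] Suc.prems by (simp_all add: leaves_first_def)
  \<comment> \<open>The phase is complete, so the invariant is used with no pending nodes.\<close>
  ultimately have "snd (fold (process_node D n \<Gamma> c ominus (Suc s)) (ord (Suc s)) ?T) (Suc s) \<alpha> =
      suffix_sum c (Suc s) \<alpha>" if "\<alpha> \<in> nodes (Suc s)" for \<alpha>
    by (intro fold_process_node[where ys = "[]"]) (use ominus that in simp_all)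
  moreover have "[1..<Suc s + 1] = [1..<s + 1] @ [Suc s]"
    by simp
  ultimately show ?case
    by (simp only: fold_append fold.simps comp_apply id_apply) blast
qed

end

theorem theorem2:
  fixes D :: "'a set" and n :: nat and \<Gamma> :: "'a list set"
    and c :: "'a pattern \<Rightarrow> 'r::{comm_semiring_0, comm_monoid_mult}"
    and ominus :: "'r \<Rightarrow> 'r \<Rightarrow> 'r"
    and ord :: "nat \<Rightarrow> 'a pattern list"
  assumes "finite D"
    and "n \<ge> 1"
    and "finite \<Gamma>"
    and "\<And>w. w \<in> \<Gamma> \<Longrightarrow> w \<noteq> [] \<and> set w \<subseteq> D"
    and "\<And>a. a \<in> D \<Longrightarrow> [a] \<in> \<Gamma>"
    and "\<And>a b. ominus a b + b = a"
    and "\<And>s. 1 \<le> s \<Longrightarrow> s \<le> n \<Longrightarrow>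
          leaves_first D n (ending_at (all_patterns D n \<Gamma>) s) (ord s)"
  shows "run_algorithm D n \<Gamma> c ominus ord = (\<Sum>x\<in>patterns_on D n 1 n. cost D n \<Gamma> c x)"
proof -
  interpret alphabet_words D n \<Gamma>
    by unfold_locales (use assms in auto)
  have "empty_pattern n \<in> nodes n"
    by (auto simp: ending_at_def all_patterns_def empty_pattern_def)
  then have "run_algorithm D n \<Gamma> c ominus ord = suffix_sum c n (empty_pattern n)"
    using fold_phases[where ominus = ominus and ord = ord and s = n and c = c, OF assms(6,7)]
    by (simp add: run_algorithm_def case_prod_unfold)
  \<comment> \<open>The root imposes no condition on x, so its suffix sum is the full sum.\<close>
  moreover have "suffix_pattern D n (empty_pattern n) x" if "x \<in> patterns_on D n 1 n" for x
    using that empty_pattern_in_patterns[of n]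
    by (simp add: patterns_on_def suffix_pattern_iff empty_pattern_def)
  then have "extensions n (empty_pattern n) = patterns_on D n 1 n"
    by (auto simp: extensions_def)
  ultimately show ?thesis
    by (simp add: suffix_sum_def)
qed

end
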